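(* Let $\mathcal P$ be the set of Newton polytopes $\operatorname{NP}(f)$ of irreducible elements $f\in F_{\mathbb Z^2}$ satisfying $|\operatorname{sm}(f)|>\sqrt{2\operatorname{vol}(\operatorname{NP}(f))}$. Then there are infinitely many triangles $P\in\mathcal P$ modulo affine linear transformations of $\mathbb R^2$ preserving $\mathbb Z^2$; that is, the triangles in $\mathcal P$ form infinitely many orbits under the group of affine linear bijections $T:\mathbb R^2\to\mathbb R^2$ with $T(\mathbb Z^2)=\mathbb Z^2$.
   Context: $F_{\mathbb Z^2}$ is the ring of finitely supported functions $f:\mathbb Z^2\to\mathbb R$ with pointwise addition and convolution product $(f*g)(c)=\sum_{a+b=c}f(a)g(b)$ (isomorphic to the Laurent polynomial ring $\mathbb R[X_1^{\pm1},X_2^{\pm1}]$); irreducibility is meant in this ring. $\operatorname{NP}(f)$ is the convex hull of $\operatorname{supp}(f)$, and $\operatorname{vol}$ is area. $\mathbb N$ is the set of nonnegative integers; for $e\in\mathbb N^2$, $|e|=e_1+e_2$. Monomials $X^e=X_1^{e_1}X_2^{e_2}$ are ordered degree-lexicographically with $X_1<X_2$: $X^e<X^{e'}$ iff $|e|<|e'|$, or $|e|=|e'|$ and $e_2<e_2'$. For $f\ne0$, $\operatorname{sm}(f)\in\mathbb N^2$ is the exponent such that $X^{\operatorname{sm}(f)}$ is the smallest monomial $X^e$ with $\sum_{a\in\mathbb Z^2}f(a)a^e\neq0$, where $a^e=a_1^{e_1}a_2^{e_2}$. *)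

theory Defs
  imports
    "HOL-Analysis.Analysis"
    "HOL-Library.Poly_Mapping"
    "HOL-Computational_Algebra.Factorial_Ring"
begin

text \<open>
  The product of the type \<open>_ \<Rightarrow>\<^sub>0 _\<close> is convolution, so this is the group ring of the
  additive group of integer pairs over the reals; \<open>irreducible\<close>, \<open>dvd\<close> and units refer to
  that ring structure.
\<close>

type_synonym FZ2 = "(int \<times> int) \<Rightarrow>\<^sub>0 real"

definition real_pt :: "int \<times> int \<Rightarrow> real ^ 2" where
  "real_pt a = vector [real_of_int (fst a), real_of_int (snd a)]"

definition newton_polytope :: "FZ2 \<Rightarrow> (real ^ 2) set" where
  "newton_polytope f = convex hull (real_pt ` Poly_Mapping.keys f)"

definition area :: "(real ^ 2) set \<Rightarrow> real" where
  "area S = measure lebesgue S"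

definition deg :: "nat \<times> nat \<Rightarrow> nat" where
  "deg e = fst e + snd e"

definition deglex_less :: "nat \<times> nat \<Rightarrow> nat \<times> nat \<Rightarrow> bool" where
  "deglex_less e e' \<longleftrightarrow> deg e < deg e' \<or> (deg e = deg e' \<and> snd e < snd e')"

text \<open>The convention \<open>0 ^ 0 = 1\<close> applies to the powers below.\<close>

definition moment :: "FZ2 \<Rightarrow> nat \<times> nat \<Rightarrow> real" where
  "moment f e = (\<Sum>a\<in>Poly_Mapping.keys f.
     Poly_Mapping.lookup f a * (real_of_int (fst a) ^ fst e * real_of_int (snd a) ^ snd e))"

text \<open>
  For \<open>f \<noteq> 0\<close> some moment is nonzero, since polynomials separate finitely many points, so
  the least exponent exists; for \<open>f = 0\<close> the value is unspecified.
\<close>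

definition sm :: "FZ2 \<Rightarrow> nat \<times> nat" where
  "sm f = (THE e. moment f e \<noteq> 0 \<and> (\<forall>e'. moment f e' \<noteq> 0 \<longrightarrow> e' = e \<or> deglex_less e e'))"

lemma sm_eqI:
  assumes "moment f e \<noteq> 0" and "\<And>e'. deglex_less e' e \<Longrightarrow> moment f e' = 0"
  shows "sm f = e"
  unfolding sm_def
proof (rule the_equality)
  have total: "e' = e'' \<or> deglex_less e' e'' \<or> deglex_less e'' e'" for e' e''
    by (cases e'; cases e'') (auto simp: deglex_less_def deg_def)
  show "moment f e \<noteq> 0 \<and> (\<forall>e'. moment f e' \<noteq> 0 \<longrightarrow> e' = e \<or> deglex_less e e')"
    using assms total by blast
  show "e' = e" if "moment f e' \<noteq> 0 \<and> (\<forall>e''. moment f e'' \<noteq> 0 \<longrightarrow> e'' = e' \<or> deglex_less e' e'')" for e'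
    using that assms by blast
qed

definition polytopes_P :: "(real ^ 2) set set" where
  "polytopes_P = {newton_polytope f | f.
     irreducible f \<and> real (deg (sm f)) > sqrt (2 * area (newton_polytope f))}"

definition affine_lattice_maps :: "(real ^ 2 \<Rightarrow> real ^ 2) set" where
  "affine_lattice_maps = {T. (\<exists>L b. linear L \<and> T = (\<lambda>x. L x + b)) \<and> bij T \<and>
     T ` range real_pt = range real_pt}"

definition affine_lattice_rel :: "((real ^ 2) set \<times> (real ^ 2) set) set" where
  "affine_lattice_rel = {(P, Q). \<exists>T\<in>affine_lattice_maps. Q = T ` P}"

lemma equiv_affine_lattice_rel: "equiv UNIV affine_lattice_rel"
proof (rule equivI)
  show "refl_on UNIV affine_lattice_rel"
  proof (rule refl_onI)
    fix P :: "(real ^ 2) set"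
    have "linear (\<lambda>x :: real ^ 2. x)" by (rule linear_id[unfolded id_def])
    then have "(\<lambda>x. x) \<in> affine_lattice_maps"
      unfolding affine_lattice_maps_def by (auto simp: bij_id[unfolded id_def] intro!: exI[of _ "\<lambda>x. x"] exI[of _ 0])
    then show "(P, P) \<in> affine_lattice_rel" unfolding affine_lattice_rel_def by force
  qed
  show "sym affine_lattice_rel"
  proof (rule symI)
    fix P Q assume "(P, Q) \<in> affine_lattice_rel"
    then obtain T L b where T: "linear L" "T = (\<lambda>x. L x + b)" "bij T"
        "T ` range real_pt = range real_pt" and Q: "Q = T ` P"
      unfolding affine_lattice_rel_def affine_lattice_maps_def by blast
    have "L = (\<lambda>x. x - b) \<circ> T" by (simp add: T(2) fun_eq_iff)
    moreover have "bij (\<lambda>x :: real ^ 2. x - b)"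
      by (rule bij_betw_byWitness[where f' = "\<lambda>x. x + b"]) auto
    ultimately have "bij L" using bij_comp[OF T(3)] by simp
    then have invL: "linear (inv L)"
      by (rule inj_linear_imp_inv_linear[OF T(1) bij_is_inj])
    have LL: "L (inv L x) = x" for x
      using \<open>bij L\<close> by (simp add: bij_is_surj surj_f_inv_f)
    define S where "S = inv T"
    have "T (inv L y - inv L b) = y" for y
      by (simp add: T(2) linear_diff[OF T(1)] LL)
    then have "S y = inv L y + - inv L b" for y
      unfolding S_def by (simp add: inv_f_eq[OF bij_is_inj[OF T(3)]])
    then have "S = (\<lambda>y. inv L y + - inv L b)" by blast
    moreover have "bij S" unfolding S_def using T(3) by (rule bij_imp_bij_inv)
    moreover have ST: "S ` T ` X = X" for X
      unfolding S_def using T(3) by (simp add: bij_is_inj image_comp)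
    ultimately have "S \<in> affine_lattice_maps"
      unfolding affine_lattice_maps_def using invL ST[of "range real_pt", unfolded T(4)] by blast
    then show "(Q, P) \<in> affine_lattice_rel"
      unfolding affine_lattice_rel_def using Q ST by blast
  qed
  show "trans affine_lattice_rel"
  proof (rule transI)
    fix P Q R assume "(P, Q) \<in> affine_lattice_rel" "(Q, R) \<in> affine_lattice_rel"
    then obtain T S where T: "T \<in> affine_lattice_maps" "Q = T ` P"
      and S: "S \<in> affine_lattice_maps" "R = S ` Q"
      unfolding affine_lattice_rel_def by blast
    obtain L b where L: "linear L" "T = (\<lambda>x. L x + b)"
      using T unfolding affine_lattice_maps_def by blast
    obtain M c where M: "linear M" "S = (\<lambda>x. M x + c)"
      using S unfolding affine_lattice_maps_def by blast
    have "S \<circ> T = (\<lambda>x. (M \<circ> L) x + (M b + c))"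
      by (auto simp: L(2) M(2) linear_add[OF M(1)])
    moreover have "linear (M \<circ> L)" using L M by (simp add: linear_compose)
    moreover have "bij (S \<circ> T)"
      using S T unfolding affine_lattice_maps_def by (auto intro: bij_comp)
    moreover have "(S \<circ> T) ` range real_pt = range real_pt"
      unfolding image_comp[symmetric] using S(1) T(1) unfolding affine_lattice_maps_def by simp
    ultimately have "S \<circ> T \<in> affine_lattice_maps"
      unfolding affine_lattice_maps_def by blast
    moreover have "R = (S \<circ> T) ` P" using S(2) T(2) by (simp add: image_comp)
    ultimately show "(P, R) \<in> affine_lattice_rel"
      unfolding affine_lattice_rel_def by blast
  qed
qed simp_all

end

theory Submission
  imports Defs
begin

text \<open>
  The triangle with vertices \<open>(0,0)\<close>, \<open>(n,0)\<close>, \<open>(-1,n+2)\<close> has twice the area \<open>n(n+2) < (n+1)\<^sup>2\<close> and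
  contains the principal lattice \<open>b, c \<ge> 0, b + c \<le> n\<close>, on which polynomials of degree at most \<open>n\<close>
  are uniquely interpolated. Expressing evaluation at the outer point \<open>(-1,n+2)\<close> through the values
  on the principal lattice gives a relation annihilating all moments of order at most \<open>n\<close>, that is
  an \<open>f\<close> with \<open>|sm(f)| = n + 1\<close>. Its Newton polytope is the whole triangle because the Lagrange
  coefficients are binomial coefficients up to sign. The edge from \<open>(0,0)\<close> to \<open>(-1,n+2)\<close> is primitive, so
  the triangle is Minkowski indecomposable and \<open>f\<close> is irreducible. The number of lattice points
  of the triangles is an unbounded invariant of the orbits.
\<close>

section \<open>Interpolation on the points of a standard simplex\<close>

text \<open>
  The products of the three binomial coefficients are the Lagrange basis polynomials of the
  principal lattice in the barycentric coordinates \<open>u, v, w\<close>. The shifts \<open>\<beta>, \<gamma>\<close> make the induction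
  work: absorbing a factor \<open>b\<close> into \<open>v gchoose b\<close> replaces \<open>b\<close> by \<open>b + 1\<close>.
\<close>

lemma trinomial_moment:
  fixes u v w \<beta> \<gamma> :: real
  assumes "u + v + w = of_nat n" and "s + t \<le> n"
  shows "(\<Sum>b\<le>n. \<Sum>c\<le>n - b. (u gchoose (n - b - c)) * (v gchoose b) * (w gchoose c)
            * (of_nat b + \<beta>) ^ s * (of_nat c + \<gamma>) ^ t) = (v + \<beta>) ^ s * (w + \<gamma>) ^ t"
  using assms
proof (induction s arbitrary: n v \<beta>)
  case 0
  have "(\<Sum>b\<le>n. \<Sum>c\<le>n - b. (u gchoose (n - b - c)) * (v gchoose b) * (w gchoose c)
            * (of_nat c + \<gamma>) ^ t) = (w + \<gamma>) ^ t"
    using 0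
  proof (induction t arbitrary: n w \<gamma>)
    case 0
    \<comment> \<open>Vandermonde, first over c and then over b, collapses the sum to (u + v + w
      choose n) = (n choose n) = 1.\<close>
    have "(\<Sum>b\<le>n. \<Sum>c\<le>n - b. (u gchoose (n - b - c)) * (v gchoose b) * (w gchoose c))
        = (\<Sum>b\<le>n. (v gchoose b) * (\<Sum>c\<le>n - b. (w gchoose c) * (u gchoose (n - b - c))))"
      by (simp add: sum_distrib_left mult_ac)
    also have "\<dots> = (\<Sum>b\<le>n. (v gchoose b) * (w + u gchoose (n - b)))"
      by (simp add: gbinomial_Vandermonde[symmetric] atMost_atLeast0)
    also have "\<dots> = (v + (w + u) gchoose n)"
      by (simp add: gbinomial_Vandermonde[symmetric] atMost_atLeast0)
    also have "v + (w + u) = of_nat n" using 0 by simp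
    finally show ?case by (simp add: binomial_gbinomial[symmetric])
  next
    case (Suc t)
    then obtain k where n: "n = Suc k" by (cases n) auto
    let ?g = "\<lambda>n w b c. (u gchoose (n - b - c)) * (v gchoose b) * (w gchoose c)"
    \<comment> \<open>The identity c (w choose c) = w (w - 1 choose c - 1) trades the factor c for
      lowering n and w by one, which keeps u + v + w = n. Reindexing raises \<gamma> by one, so w +
      \<gamma> is unchanged.\<close>
    have absorb: "(\<Sum>c\<le>n - b. of_nat c * ?g n w b c * (of_nat c + \<gamma>) ^ t)
        = w * (\<Sum>c\<le>k - b. ?g k (w - 1) b c * (of_nat c + (1 + \<gamma>)) ^ t)" if "b \<le> k" for b
    proof -
      have *: "n - b = Suc (k - b)" using that n by simp
      have step: "of_nat (Suc c) * ?g n w b (Suc c) * (of_nat (Suc c) + \<gamma>) ^ t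
        = w * (?g k (w - 1) b c * (of_nat c + (1 + \<gamma>)) ^ t)" for c
      proof -
        have "of_nat (Suc c) * ?g n w b (Suc c) * (of_nat (Suc c) + \<gamma>) ^ t
            = (of_nat (Suc c) * (w gchoose Suc c)) * ((u gchoose (n - b - Suc c)) * (v gchoose b))
              * (of_nat (Suc c) + \<gamma>) ^ t"
          by (simp only: mult_ac)
        also have "\<dots> = (w * (w - 1 gchoose c)) * ((u gchoose (k - b - c)) * (v gchoose b))
              * (of_nat c + (1 + \<gamma>)) ^ t"
          unfolding gbinomial_absorption * diff_Suc_Suc by (simp add: add_ac)
        finally show ?thesis by (simp only: mult_ac)
      qed
      show ?thesis
        unfolding * sum.atMost_Suc_shift sum_distrib_left step[unfolded *] by simp
    qed
    \<comment> \<open>The row b = n contains only c = 0, where the factor c makes it vanish.\<close>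
    have "(\<Sum>b\<le>n. \<Sum>c\<le>n - b. of_nat c * ?g n w b c * (of_nat c + \<gamma>) ^ t)
        = w * (\<Sum>b\<le>k. \<Sum>c\<le>k - b. ?g k (w - 1) b c * (of_nat c + (1 + \<gamma>)) ^ t)"
      unfolding n sum.atMost_Suc using absorb[unfolded n] by (simp add: sum_distrib_left)
    also have "(\<Sum>b\<le>k. \<Sum>c\<le>k - b. ?g k (w - 1) b c * (of_nat c + (1 + \<gamma>)) ^ t)
        = (w - 1 + (1 + \<gamma>)) ^ t"
      using Suc.prems n by (intro Suc.IH) auto
    finally have 1: "(\<Sum>b\<le>n. \<Sum>c\<le>n - b. of_nat c * ?g n w b c * (of_nat c + \<gamma>) ^ t)
        = w * (w + \<gamma>) ^ t" by simp
    have 2: "(\<Sum>b\<le>n. \<Sum>c\<le>n - b. ?g n w b c * (of_nat c + \<gamma>) ^ t) = (w + \<gamma>) ^ t"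
      using Suc.prems by (intro Suc.IH) auto
    have "(\<Sum>b\<le>n. \<Sum>c\<le>n - b. ?g n w b c * (of_nat c + \<gamma>) ^ Suc t)
      = (\<Sum>b\<le>n. \<Sum>c\<le>n - b. of_nat c * ?g n w b c * (of_nat c + \<gamma>) ^ t)
        + \<gamma> * (\<Sum>b\<le>n. \<Sum>c\<le>n - b. ?g n w b c * (of_nat c + \<gamma>) ^ t)"
      unfolding sum_distrib_left sum.distrib[symmetric] by (simp add: algebra_simps)
    then show ?case unfolding 1 2 by (simp add: algebra_simps)
  qed
  then show ?case by simp
next
  case (Suc s)
  then obtain k where n: "n = Suc k" by (cases n) auto
  let ?g = "\<lambda>n v b c. (u gchoose (n - b - c)) * (v gchoose b) * (w gchoose c)"
  have absorb: "of_nat (Suc b) * ?g n v (Suc b) c * (of_nat (Suc b) + \<beta>) ^ s * (of_nat c + \<gamma>) ^ t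
      = v * (?g k (v - 1) b c * (of_nat b + (1 + \<beta>)) ^ s * (of_nat c + \<gamma>) ^ t)" for b c
  proof -
    have "of_nat (Suc b) * ?g n v (Suc b) c * (of_nat (Suc b) + \<beta>) ^ s * (of_nat c + \<gamma>) ^ t
        = (of_nat (Suc b) * (v gchoose Suc b)) * ((u gchoose (n - Suc b - c)) * (w gchoose c))
          * (of_nat (Suc b) + \<beta>) ^ s * (of_nat c + \<gamma>) ^ t"
      by (simp only: mult_ac)
    also have "\<dots> = (v * (v - 1 gchoose b)) * ((u gchoose (k - b - c)) * (w gchoose c))
          * (of_nat b + (1 + \<beta>)) ^ s * (of_nat c + \<gamma>) ^ t"
      unfolding gbinomial_absorption n diff_Suc_Suc by (simp add: add_ac)
    finally show ?thesis by (simp only: mult_ac)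
  qed
  have "(\<Sum>b\<le>n. \<Sum>c\<le>n - b. of_nat b * ?g n v b c * (of_nat b + \<beta>) ^ s * (of_nat c + \<gamma>) ^ t)
      = v * (\<Sum>b\<le>k. \<Sum>c\<le>k - b. ?g k (v - 1) b c * (of_nat b + (1 + \<beta>)) ^ s * (of_nat c + \<gamma>) ^ t)"
    unfolding n sum.atMost_Suc_shift sum_distrib_left absorb[unfolded n] by simp
  also have "(\<Sum>b\<le>k. \<Sum>c\<le>k - b. ?g k (v - 1) b c * (of_nat b + (1 + \<beta>)) ^ s * (of_nat c + \<gamma>) ^ t)
      = (v - 1 + (1 + \<beta>)) ^ s * (w + \<gamma>) ^ t"
    using Suc.prems n by (intro Suc.IH) auto
  finally have 1: "(\<Sum>b\<le>n. \<Sum>c\<le>n - b. of_nat b * ?g n v b c * (of_nat b + \<beta>) ^ s * (of_nat c + \<gamma>) ^ t)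
      = v * ((v + \<beta>) ^ s * (w + \<gamma>) ^ t)" by simp
  have 2: "(\<Sum>b\<le>n. \<Sum>c\<le>n - b. ?g n v b c * (of_nat b + \<beta>) ^ s * (of_nat c + \<gamma>) ^ t)
      = (v + \<beta>) ^ s * (w + \<gamma>) ^ t"
    using Suc.prems by (intro Suc.IH) auto
  have "(\<Sum>b\<le>n. \<Sum>c\<le>n - b. ?g n v b c * (of_nat b + \<beta>) ^ Suc s * (of_nat c + \<gamma>) ^ t)
    = (\<Sum>b\<le>n. \<Sum>c\<le>n - b. of_nat b * ?g n v b c * (of_nat b + \<beta>) ^ s * (of_nat c + \<gamma>) ^ t)
      + \<beta> * (\<Sum>b\<le>n. \<Sum>c\<le>n - b. ?g n v b c * (of_nat b + \<beta>) ^ s * (of_nat c + \<gamma>) ^ t)"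
    unfolding sum_distrib_left sum.distrib[symmetric] by (simp add: algebra_simps)
  then show ?case unfolding 1 2 by (simp add: algebra_simps)
qed

lemma gbinomial_minus_one: "(- 1 :: real) gchoose k = (- 1) ^ k"
  using gbinomial_minus[of "1 :: real" k] by (simp add: binomial_gbinomial[symmetric])

text \<open>The outer point has barycentric coordinates u = v = -1 and w = n + 2, which sum to n.
  Since (-1 choose k) = (-1)^k, the Lagrange coefficients become signed binomials in c
  alone.\<close>

lemma moment_at_outer_point:
  assumes "s + t \<le> n"
  shows "(\<Sum>b\<le>n. \<Sum>c\<le>n - b. (- 1) ^ (n - c) * real (n + 2 choose c) * real b ^ s * real c ^ t)
    = (- 1) ^ s * real (n + 2) ^ t"
proof -
  have sgn: "(- 1 :: real) ^ (n - (b + c)) * (- 1) ^ b = (- 1) ^ (n - c)" if "b \<le> n" "c \<le> n - b" for b c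
    using that by (simp add: power_add[symmetric])
  have "(\<Sum>b\<le>n. \<Sum>c\<le>n - b. (- 1) ^ (n - c) * real (n + 2 choose c) * real b ^ s * real c ^ t)
    = (\<Sum>b\<le>n. \<Sum>c\<le>n - b. (- 1 gchoose (n - b - c)) * (- 1 gchoose b) * (real (n + 2) gchoose c)
            * (of_nat b + 0) ^ s * (of_nat c + 0) ^ t)"
    unfolding gbinomial_minus_one by (intro sum.cong refl) (simp add: sgn binomial_gbinomial)
  also have "\<dots> = (- 1 + 0) ^ s * (real (n + 2) + 0) ^ t"
    using assms by (intro trinomial_moment) auto
  finally show ?thesis by simp
qed

section \<open>Vertices of supports of products\<close>

definition lin :: "int \<times> int \<Rightarrow> int \<times> int \<Rightarrow> int" where
  "lin p x = fst p * fst x + snd p * snd x"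

text \<open>The tie-break by q selects one end of the face on which p is maximal. With the normals
  of two adjacent edges as p and q, this is their common vertex.\<close>

definition lex_vertex :: "int \<times> int \<Rightarrow> int \<times> int \<Rightarrow> (int \<times> int) set \<Rightarrow> int \<times> int \<Rightarrow> bool" where
  "lex_vertex p q S a \<longleftrightarrow> a \<in> S \<and> (\<forall>x\<in>S. x \<noteq> a \<longrightarrow> lin p x < lin p a \<or> lin p x = lin p a \<and> lin q x < lin q a)"

lemma lin_add: "lin p (x + y) = lin p x + lin p y"
  by (simp add: lin_def algebra_simps)

lemma lin_inject:
  assumes "lin p x = lin p y" "lin q x = lin q y" "fst p * snd q \<noteq> snd p * fst q"
  shows "x = y"
proof -
  have 1: "(fst p * snd q - snd p * fst q) * (fst x - fst y)
      = snd q * (lin p x - lin p y) - snd p * (lin q x - lin q y)"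
    by (simp add: lin_def algebra_simps)
  have 2: "(fst p * snd q - snd p * fst q) * (snd x - snd y)
      = fst p * (lin q x - lin q y) - fst q * (lin p x - lin p y)"
    by (simp add: lin_def algebra_simps)
  show ?thesis using 1 2 assms by (simp add: prod_eq_iff)
qed

lemma lex_vertex_exists:
  assumes "finite S" "S \<noteq> {}" "fst p * snd q \<noteq> snd p * fst q"
  shows "\<exists>a. lex_vertex p q S a"
  using assms(1,2)
proof (induction rule: finite_ne_induct)
  case (singleton x)
  then show ?case by (auto simp: lex_vertex_def)
next
  case (insert x F)
  then obtain a where a: "lex_vertex p q F a" by blast
  show ?case
  proof (cases "lin p x < lin p a \<or> lin p x = lin p a \<and> lin q x < lin q a")
    case True
    then have "lex_vertex p q (insert x F) a" using a by (auto simp: lex_vertex_def)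
    then show ?thesis ..
  next
    case False
    moreover have "x \<noteq> a" using a insert.hyps by (auto simp: lex_vertex_def)
    ultimately have "lin p a < lin p x \<or> lin p a = lin p x \<and> lin q a < lin q x"
      using lin_inject[of p x a q] assms(3) by linarith
    then have "lex_vertex p q (insert x F) x"
      using a unfolding lex_vertex_def by (metis insert_iff order.strict_trans)
    then show ?thesis ..
  qed
qed

lemma lex_vertex_unique: "lex_vertex p q S a \<Longrightarrow> lex_vertex p q S b \<Longrightarrow> a = b"
  unfolding lex_vertex_def by (cases "a = b") fastforce+

lemma lex_vertex_le: "lex_vertex p q S a \<Longrightarrow> x \<in> S \<Longrightarrow> lin p x \<le> lin p a"
  unfolding lex_vertex_def by (cases "x = a") auto

lemma lookup_mult_unique_decomposition:
  fixes g h :: "'a :: ab_group_add \<Rightarrow>\<^sub>0 'b :: comm_semiring_0"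
  assumes "\<And>x y. x \<in> Poly_Mapping.keys g \<Longrightarrow> y \<in> Poly_Mapping.keys h \<Longrightarrow> x + y = a + b \<Longrightarrow> x = a"
  shows "Poly_Mapping.lookup (g * h) (a + b) = Poly_Mapping.lookup g a * Poly_Mapping.lookup h b"
proof -
  have eq: "a + b = l + q \<longleftrightarrow> q = a + b - l" for l q :: 'a
    by (auto simp: algebra_simps)
  have zero: "Poly_Mapping.lookup g l * Poly_Mapping.lookup h (a + b - l)
      = (Poly_Mapping.lookup g a * Poly_Mapping.lookup h b when l = a)" for l
  proof (cases "l = a")
    case False
    then have "l \<notin> Poly_Mapping.keys g \<or> a + b - l \<notin> Poly_Mapping.keys h"
      using assms[of l "a + b - l"] by auto
    then show ?thesis using False by (auto simp: in_keys_iff)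
  qed simp
  show ?thesis unfolding lookup_mult eq Sum_any_when_equal zero by simp
qed

text \<open>The order is compatible with addition, so a + b beats every other sum and arises from
  one pair only. Its coefficient is a product of two nonzero reals and cannot cancel.\<close>

lemma lex_vertex_mult:
  fixes g h :: FZ2
  assumes a: "lex_vertex p q (Poly_Mapping.keys g) a" and b: "lex_vertex p q (Poly_Mapping.keys h) b"
  shows "lex_vertex p q (Poly_Mapping.keys (g * h)) (a + b)"
proof -
  let ?less = "\<lambda>x y. lin p x < lin p y \<or> lin p x = lin p y \<and> lin q x < lin q y"
  have less: "?less (x + y) (a + b)"
    if "x \<in> Poly_Mapping.keys g" "y \<in> Poly_Mapping.keys h" "x \<noteq> a \<or> y \<noteq> b" for x y
  proof -
    have "x = a \<or> ?less x a" "y = b \<or> ?less y b"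
      using a b that(1,2) by (auto simp: lex_vertex_def)
    with that(3) show ?thesis unfolding lin_add by auto
  qed
  have "Poly_Mapping.lookup (g * h) (a + b) = Poly_Mapping.lookup g a * Poly_Mapping.lookup h b"
    by (rule lookup_mult_unique_decomposition) (use less in fastforce)
  moreover have "a \<in> Poly_Mapping.keys g" "b \<in> Poly_Mapping.keys h"
    using a b by (auto simp: lex_vertex_def)
  ultimately have "a + b \<in> Poly_Mapping.keys (g * h)" by (simp add: in_keys_iff)
  moreover have "?less z (a + b)" if "z \<in> Poly_Mapping.keys (g * h)" "z \<noteq> a + b" for z
  proof -
    obtain x y where "z = x + y" "x \<in> Poly_Mapping.keys g" "y \<in> Poly_Mapping.keys h"
      using \<open>z \<in> _\<close> keys_mult[of g h] by blast
    then show ?thesis using less[of x y] \<open>z \<noteq> a + b\<close> by auto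
  qed
  ultimately show ?thesis unfolding lex_vertex_def by blast
qed

text \<open>Vertex form of Ostrowski's NP(gh) = NP(g) + NP(h): both factors have extremal points,
  and by uniqueness their sum is the extremal point of the product.\<close>

lemma lex_vertex_factors:
  fixes g h :: FZ2
  assumes "lex_vertex p q (Poly_Mapping.keys (g * h)) z" "fst p * snd q \<noteq> snd p * fst q"
  obtains a b where "lex_vertex p q (Poly_Mapping.keys g) a" "lex_vertex p q (Poly_Mapping.keys h) b"
    "a + b = z"
proof -
  have "g \<noteq> 0" "h \<noteq> 0" using assms(1) by (auto simp: lex_vertex_def)
  then obtain a b where "lex_vertex p q (Poly_Mapping.keys g) a" "lex_vertex p q (Poly_Mapping.keys h) b"
    using lex_vertex_exists[OF _ _ assms(2)] by (metis finite_keys keys_eq_empty)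
  with lex_vertex_mult lex_vertex_unique assms(1) that show thesis by metis
qed

lemma keys_singleton_dvd_one:
  fixes g :: FZ2
  assumes "Poly_Mapping.keys g = {a}"
  shows "g dvd 1"
proof -
  define r where "r = Poly_Mapping.lookup g a"
  have "r \<noteq> 0" using assms unfolding r_def by (metis in_keys_iff insertI1)
  have "g = Poly_Mapping.single a r"
    using assms by (intro poly_mapping_eqI) (auto simp: lookup_single when_def r_def in_keys_iff[symmetric] simp flip: in_keys_iff)
  then have "g * Poly_Mapping.single (- a) (1 / r) = 1"
    using \<open>r \<noteq> 0\<close> by (simp add: mult_single)
  then show ?thesis by (metis dvd_triv_left)
qed

section \<open>The triangles\<close>

context
  fixes n :: nat
  assumes n_pos: "n > 0"
begin

text \<open>Outer normals of the three edges of the triangle with vertices \<open>(0,0)\<close>, \<open>(n,0)\<close>, \<open>(-1,n+2)\<close>.\<close>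

abbreviation (input) "bottom \<equiv> (0 :: int, - 1 :: int)"
abbreviation (input) "left \<equiv> (- int n - 2, - 1 :: int)"
abbreviation (input) "right \<equiv> (int n + 2, int n + 1)"

text \<open>In a factorization each vertex of the triangle splits into vertices of the factors.
  Along the primitive left edge one factor does not move, and such a factor is a monomial, hence a
  unit.\<close>

lemma irreducible_of_vertices:
  fixes f :: FZ2
  assumes A: "lex_vertex bottom left (Poly_Mapping.keys f) (0, 0)"
    and C: "lex_vertex left right (Poly_Mapping.keys f) (- 1, int n + 2)"
    and B: "lex_vertex right bottom (Poly_Mapping.keys f) (int n, 0)"
  shows "irreducible f"
proof -
  have inj: "fst bottom * snd left \<noteq> snd bottom * fst left" "fst left * snd right \<noteq> snd left * fst right"
      "fst right * snd bottom \<noteq> snd right * fst bottom"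
  proof -
    have "0 < int n * int n + 2 * int n" using n_pos by (intro add_pos_pos mult_pos_pos) auto
    then show "fst left * snd right \<noteq> snd left * fst right" by (simp add: algebra_simps)
  qed (use n_pos in auto)
  have key: "g dvd 1 \<or> h dvd 1" if f: "f = g * h" for g h :: FZ2
  proof -
    obtain a a' where a: "lex_vertex bottom left (Poly_Mapping.keys g) a"
        "lex_vertex bottom left (Poly_Mapping.keys h) a'" "a + a' = (0, 0)"
      using A inj(1) unfolding f by (rule lex_vertex_factors)
    obtain c c' where c: "lex_vertex left right (Poly_Mapping.keys g) c"
        "lex_vertex left right (Poly_Mapping.keys h) c'" "c + c' = (- 1, int n + 2)"
      using C inj(2) unfolding f by (rule lex_vertex_factors)
    obtain b b' where b: "lex_vertex right bottom (Poly_Mapping.keys g) b"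
        "lex_vertex right bottom (Poly_Mapping.keys h) b'" "b + b' = (int n, 0)"
      using B inj(3) unfolding f by (rule lex_vertex_factors)
    have mem: "a \<in> Poly_Mapping.keys g" "c \<in> Poly_Mapping.keys g" "a' \<in> Poly_Mapping.keys h" "c' \<in> Poly_Mapping.keys h"
      using a c by (auto simp: lex_vertex_def)
    have "lin left a \<le> lin left c" "lin left a' \<le> lin left c'"
      using lex_vertex_le[OF c(1)] lex_vertex_le[OF c(2)] mem by auto
    \<comment> \<open>Both ends of the left edge have the same value under \<open>left\<close>, so
      two inequalities whose sum is an equality must each be equalities.\<close>
    moreover have "lin left (a + a') = lin left (c + c')"
      unfolding a(3) c(3) by (simp add: lin_def algebra_simps)
    ultimately have left: "lin left a = lin left c" "lin left a' = lin left c'"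
      unfolding lin_add by linarith+
    have "lin right c \<le> lin right b" "lin right c' \<le> lin right b'"
      using lex_vertex_le[OF b(1)] lex_vertex_le[OF b(2)] mem by auto
    moreover have "lin right (b + b') = lin right (c + c')"
      unfolding b(3) c(3) by (simp add: lin_def algebra_simps)
    ultimately have right: "lin right b = lin right c" "lin right b' = lin right c'"
      unfolding lin_add by linarith+
    have "lin bottom c \<le> lin bottom a" "lin bottom c' \<le> lin bottom a'"
      using lex_vertex_le[OF a(1)] lex_vertex_le[OF a(2)] mem by auto
    then have bottom: "snd a \<le> snd c" "snd a' \<le> snd c'" by (simp_all add: lin_def)
    text \<open>The left edge is primitive, so the corresponding face of one of the factors is a point.\<close>
    have "snd c - snd a = (int n + 2) * (fst a - fst c)" "snd c' - snd a' = (int n + 2) * (fst a' - fst c')"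
      using left by (simp_all add: lin_def algebra_simps)
    then have "0 \<le> (int n + 2) * (fst a - fst c)" "0 \<le> (int n + 2) * (fst a' - fst c')"
      using bottom by linarith+
    then have "0 \<le> fst a - fst c" "0 \<le> fst a' - fst c'"
      by (simp_all add: zero_le_mult_iff)
    moreover have "fst a + fst a' = 0" "fst c + fst c' = - 1"
      using a(3) c(3) by (simp_all add: prod_eq_iff)
    \<comment> \<open>The two differences are nonnegative integers with sum 1, so one of them is
      0.\<close>
    ultimately have "fst a = fst c \<or> fst a' = fst c'" by linarith
    then have "a = c \<or> a' = c'"
      using left by (auto simp: lin_def prod_eq_iff)
    moreover have unit: "k dvd 1"
      if k: "lex_vertex bottom left (Poly_Mapping.keys k) d" "lex_vertex left right (Poly_Mapping.keys k) d"
        "lex_vertex right bottom (Poly_Mapping.keys k) e" "lin right e = lin right d" for k :: FZ2 and d e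
    proof -
      have "x = d" if x: "x \<in> Poly_Mapping.keys k" for x
      proof -
        have le: "lin bottom x \<le> lin bottom d" "lin left x \<le> lin left d" "lin right x \<le> lin right d"
          using lex_vertex_le[OF k(1) x] lex_vertex_le[OF k(2) x] lex_vertex_le[OF k(3) x] k(4) by simp_all
        \<comment> \<open>The primitive edge normals, weighted by the lattice lengths n, 1, 1 of the
          edges, sum to 0. All three functionals are maximal at d, so no point of the support can
          fall below d in any of them.\<close>
        have rel: "int n * lin bottom y + lin left y + lin right y = 0" for y
          by (simp add: lin_def algebra_simps)
        have "int n * lin bottom x \<le> int n * lin bottom d"
          using le(1) by (intro mult_left_mono) auto
        then have "int n * lin bottom x = int n * lin bottom d" "lin left x = lin left d"
          using le(2,3) rel[of x] rel[of d] by linarith+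
        then show "x = d" using n_pos inj(1) by (intro lin_inject[of bottom _ _ left]) auto
      qed
      moreover have "d \<in> Poly_Mapping.keys k" using k(1) by (simp add: lex_vertex_def)
      ultimately have "Poly_Mapping.keys k = {d}" by blast
      then show ?thesis by (rule keys_singleton_dvd_one)
    qed
    ultimately show ?thesis
      using unit[of g a b] unit[of h a' b'] a b c right by metis
  qed
  \<comment> \<open>An inverse h would have the negated vertices (0, 0) and (1, -n - 2). The second
    lies strictly lower, although the first maximizes \<open>bottom\<close>.\<close>
  have "\<not> f dvd 1"
  proof
    assume "f dvd 1"
    then obtain h where h: "1 = f * h" by (rule dvdE)
    have one: "lex_vertex p q (Poly_Mapping.keys (1 :: FZ2)) z \<longleftrightarrow> z = 0" for p q z
      by (auto simp: lex_vertex_def)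
    have "h \<noteq> 0" using h by auto
    then obtain a c where a: "lex_vertex bottom left (Poly_Mapping.keys h) a"
      and c: "lex_vertex left right (Poly_Mapping.keys h) c"
      using lex_vertex_exists inj by (metis finite_keys keys_eq_empty)
    have "(0, 0) + a = 0" "(- 1, int n + 2) + c = 0"
      using lex_vertex_mult[OF A a] lex_vertex_mult[OF C c] unfolding h[symmetric] one by auto
    moreover have "lin bottom c \<le> lin bottom a"
      using lex_vertex_le[OF a] c by (auto simp: lex_vertex_def)
    ultimately show False by (auto simp: lin_def prod_eq_iff)
  qed
  moreover have "f \<noteq> 0" using A by (auto simp: lex_vertex_def)
  ultimately show ?thesis using key unfolding irreducible_def by blast
qed

section \<open>The polynomial encoding the interpolation relation\<close>

definition simplex_pts :: "(int \<times> int) set" where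
  "simplex_pts = (\<lambda>(b, c). (int b, int c)) ` (SIGMA b:{..n}. {..n - b})"

text \<open>Pairing these weights with a polynomial gives its value at the outer point minus the
  value interpolated from the principal lattice.\<close>

definition tri_coeff :: "int \<times> int \<Rightarrow> real" where
  "tri_coeff a = (if a = (- 1, int n + 2) then 1
     else if a \<in> simplex_pts then - ((- 1) ^ (n - nat (snd a)) * real (n + 2 choose nat (snd a)))
     else 0)"

definition tri_poly :: FZ2 where
  "tri_poly = Abs_poly_mapping tri_coeff"

lemma simplex_pts_iff: "a \<in> simplex_pts \<longleftrightarrow> 0 \<le> fst a \<and> 0 \<le> snd a \<and> fst a + snd a \<le> int n"
proof
  assume "0 \<le> fst a \<and> 0 \<le> snd a \<and> fst a + snd a \<le> int n"
  then have "a = (\<lambda>(b, c). (int b, int c)) (nat (fst a), nat (snd a))"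
    "(nat (fst a), nat (snd a)) \<in> (SIGMA b:{..n}. {..n - b})"
    by (auto simp: prod_eq_iff)
  then show "a \<in> simplex_pts" unfolding simplex_pts_def by blast
qed (auto simp: simplex_pts_def)

text \<open>Since c <= n < n + 2, no binomial vanishes; in particular all three vertices carry
  nonzero coefficients.\<close>

lemma tri_coeff_support: "{a. tri_coeff a \<noteq> 0} = insert (- 1, int n + 2) simplex_pts"
proof -
  have "n + 2 choose nat (snd a) \<noteq> 0" if "a \<in> simplex_pts" for a
    using that unfolding simplex_pts_iff by (auto simp: binomial_eq_0_iff)
  then show ?thesis by (auto simp: tri_coeff_def)
qed

lemma finite_simplex_pts: "finite simplex_pts"
  unfolding simplex_pts_def by simp

lemma lookup_tri_poly: "Poly_Mapping.lookup tri_poly = tri_coeff"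
  unfolding tri_poly_def using tri_coeff_support finite_simplex_pts by simp

lemma keys_tri_poly: "Poly_Mapping.keys tri_poly = insert (- 1, int n + 2) simplex_pts"
  using tri_coeff_support by (simp add: Poly_Mapping.keys.rep_eq lookup_tri_poly)

lemma irreducible_tri_poly: "irreducible tri_poly"
proof (rule irreducible_of_vertices)
  show "lex_vertex bottom left (Poly_Mapping.keys tri_poly) (0, 0)"
    unfolding lex_vertex_def keys_tri_poly simplex_pts_iff
    by (auto simp: lin_def simplex_pts_iff intro!: mult_neg_pos)
  show "lex_vertex left right (Poly_Mapping.keys tri_poly) (- 1, int n + 2)"
    unfolding lex_vertex_def
  proof (intro conjI ballI impI)
    fix a assume "a \<in> Poly_Mapping.keys tri_poly" "a \<noteq> (- 1, int n + 2)"
    then have a: "0 \<le> fst a" "0 \<le> snd a" by (auto simp: keys_tri_poly simplex_pts_iff)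
    have C: "lin left (- 1, int n + 2) = 0" by (simp add: lin_def)
    show "lin left a < lin left (- 1, int n + 2) \<or> lin left a = lin left (- 1, int n + 2) \<and>
        lin right a < lin right (- 1, int n + 2)"
    proof (cases "a = (0, 0)")
      case True
      have "0 < int n * (int n + 2)" using n_pos by simp
      then show ?thesis using True C by (simp add: lin_def algebra_simps)
    next
      case False
      then have "0 < (int n + 2) * fst a + snd a"
        using a by (cases "fst a = 0") (auto simp: prod_eq_iff intro: add_pos_nonneg)
      moreover have "lin left a = - ((int n + 2) * fst a + snd a)" by (simp add: lin_def algebra_simps)
      ultimately show ?thesis unfolding C by linarith
    qed
  qed (simp add: keys_tri_poly)
  have "(int n + 2) * x + (int n + 1) * y < (int n + 2) * int n"
    if "0 \<le> x" "0 \<le> y" "x + y \<le> int n" "(x, y) \<noteq> (int n, 0)" for x y :: int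
  proof -
    \<comment> \<open>In this form a maximum over the simplex forces x + y = n and y = 0. The outer
      point ties with (n, 0) under \<open>right\<close> and loses under
      \<open>bottom\<close>.\<close>
    have "(int n + 2) * x + (int n + 1) * y = (int n + 2) * (x + y) - y" by (simp add: algebra_simps)
    moreover have "(int n + 2) * (x + y) \<le> (int n + 2) * int n"
      using that by (intro mult_left_mono) auto
    moreover have "(int n + 2) * (x + y) < (int n + 2) * int n" if "y = 0"
      using that \<open>x + y \<le> int n\<close> \<open>(x, y) \<noteq> (int n, 0)\<close> by (intro mult_strict_left_mono) auto
    ultimately show ?thesis using \<open>0 \<le> y\<close> by (cases "y = 0") linarith+
  qed
  then show "lex_vertex right bottom (Poly_Mapping.keys tri_poly) (int n, 0)"
    unfolding lex_vertex_def keys_tri_poly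
    by (auto simp: lin_def simplex_pts_iff algebra_simps)
qed

section \<open>Moments and the smallest exponent\<close>

lemma moment_tri_poly:
  "moment tri_poly (s, t) = (- 1) ^ s * real (n + 2) ^ t
    - (\<Sum>b\<le>n. \<Sum>c\<le>n - b. (- 1) ^ (n - c) * real (n + 2 choose c) * real b ^ s * real c ^ t)"
proof -
  have notin: "(- 1, int n + 2) \<notin> simplex_pts" by (simp add: simplex_pts_iff)
  have inj: "inj_on (\<lambda>(b, c). (int b, int c)) A" for A by (auto simp: inj_on_def)
  have "(\<Sum>a\<in>simplex_pts. tri_coeff a * (real_of_int (fst a) ^ s * real_of_int (snd a) ^ t))
      = (\<Sum>a\<in>simplex_pts. - ((- 1) ^ (n - nat (snd a)) * real (n + 2 choose nat (snd a))
          * (real_of_int (fst a) ^ s * real_of_int (snd a) ^ t)))"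
    using notin by (intro sum.cong) (auto simp: tri_coeff_def)
  also have "\<dots> = - (\<Sum>b\<le>n. \<Sum>c\<le>n - b. (- 1) ^ (n - c) * real (n + 2 choose c) * real b ^ s * real c ^ t)"
    unfolding simplex_pts_def sum.reindex[OF inj]
    by (simp add: sum.Sigma sum_negf case_prod_unfold mult_ac)
  finally show ?thesis
    using notin finite_simplex_pts
    unfolding moment_def keys_tri_poly lookup_tri_poly
    by (simp add: tri_coeff_def add_ac)
qed

lemma moment_tri_poly_eq_0: "s + t \<le> n \<Longrightarrow> moment tri_poly (s, t) = 0"
  unfolding moment_tri_poly using moment_at_outer_point by simp

text \<open>
  The polynomial \<open>X\<^sub>1 (X\<^sub>1 - 1) \<dots> (X\<^sub>1 - n)\<close> of degree \<open>n + 1\<close> vanishes on the support of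
  \<^term>\<open>tri_poly\<close> except at the vertex \<open>(-1,n+2)\<close>.
\<close>

lemma moment_tri_poly_neq_0: "moment tri_poly (n + 1, 0) \<noteq> 0"
proof
  assume top: "moment tri_poly (n + 1, 0) = 0"
  define q :: "real poly" where "q = (\<Prod>i\<le>n. [:- real i, 1:])"
  have deg: "degree q \<le> n + 1"
    unfolding q_def using degree_prod_sum_le[of "{..n}" "\<lambda>i. [:- real i, 1:]"] by simp
  have zero: "moment tri_poly (k, 0) = 0" if "k \<le> n + 1" for k
    using that top moment_tri_poly_eq_0[of k 0] by (cases "k = n + 1") auto
  have "(\<Sum>a\<in>Poly_Mapping.keys tri_poly. tri_coeff a * poly q (real_of_int (fst a)))
      = (\<Sum>a\<in>Poly_Mapping.keys tri_poly. \<Sum>k\<le>degree q. coeff q k * (tri_coeff a * real_of_int (fst a) ^ k))"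
    by (simp add: poly_altdef sum_distrib_left mult_ac)
  also have "\<dots> = (\<Sum>k\<le>degree q. coeff q k * moment tri_poly (k, 0))"
    by (subst sum.swap) (simp add: moment_def lookup_tri_poly sum_distrib_left)
  also have "\<dots> = 0"
    using zero deg by simp
  finally have "(\<Sum>a\<in>Poly_Mapping.keys tri_poly. tri_coeff a * poly q (real_of_int (fst a))) = 0" .
  moreover have "poly q (real_of_int (fst a)) = 0" if "a \<in> simplex_pts" for a
  proof -
    have "nat (fst a) \<le> n" "real (nat (fst a)) = real_of_int (fst a)"
      using that by (auto simp: simplex_pts_iff)
    then show ?thesis unfolding q_def poly_prod by (intro prod_zero bexI[of _ "nat (fst a)"]) auto
  qed
  moreover have "(- 1, int n + 2) \<notin> simplex_pts" by (simp add: simplex_pts_iff)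
  ultimately have "poly q (- 1) = 0"
    using finite_simplex_pts by (simp add: keys_tri_poly tri_coeff_def)
  then show False unfolding q_def poly_prod by (auto simp: prod_zero_iff)
qed

text \<open>As X_1 < X_2, the exponent (n + 1, 0) is the least one of degree n + 1, so every smaller
  exponent has degree at most n.\<close>

lemma sm_tri_poly: "sm tri_poly = (n + 1, 0)"
proof (rule sm_eqI[OF moment_tri_poly_neq_0])
  fix e' assume "deglex_less e' (n + 1, 0)"
  then show "moment tri_poly e' = 0"
    by (cases e') (auto simp: deglex_less_def deg_def intro: moment_tri_poly_eq_0)
qed

section \<open>Newton polytope, area and lattice points\<close>

definition tri_vertices :: "(real ^ 2) set" where
  "tri_vertices = {real_pt (0, 0), real_pt (int n, 0), real_pt (- 1, int n + 2)}"

lemma newton_polytope_tri_poly: "newton_polytope tri_poly = convex hull tri_vertices"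
proof
  have "real_pt a \<in> convex hull tri_vertices" if a: "a \<in> simplex_pts" for a
  proof -
    \<comment> \<open>The barycentric coordinates u and v solve x = n u - v and y = (n + 2)
      v.\<close>
    define x y where "x = real_of_int (fst a)" and "y = real_of_int (snd a)"
    define v where "v = y / (real n + 2)"
    define u where "u = (x + v) / real n"
    have xy: "0 \<le> x" "0 \<le> y" "x + y \<le> real n"
      using a unfolding x_def y_def simplex_pts_iff by (auto simp flip: of_int_add)
    have yv: "y = (real n + 2) * v" by (simp add: v_def)
    have xu: "x = real n * u - v" using n_pos by (simp add: u_def)
    have "0 \<le> v" using xy by (simp add: v_def)
    moreover have "0 \<le> u" using xy \<open>0 \<le> v\<close> by (simp add: u_def)
    \<comment> \<open>Indeed n (u + v) = x + y - v.\<close>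
    moreover have "real n * (u + v) \<le> real n * 1"
      using xy(3) \<open>0 \<le> v\<close> unfolding xu yv by (simp add: algebra_simps)
    then have "u + v \<le> 1" using n_pos by simp
    moreover have "real_pt a = (1 - u - v) *\<^sub>R real_pt (0, 0) + u *\<^sub>R real_pt (int n, 0)
        + v *\<^sub>R real_pt (- 1, int n + 2)"
      using xu yv unfolding x_def y_def
      by (simp add: real_pt_def vec_eq_iff forall_2 algebra_simps)
    moreover have "0 \<le> 1 - u - v" "1 - u - v + u + v = 1"
      using \<open>u + v \<le> 1\<close> by simp_all
    ultimately show ?thesis unfolding tri_vertices_def convex_hull_3 by blast
  qed
  moreover have "real_pt (- 1, int n + 2) \<in> convex hull tri_vertices"
    by (rule hull_inc) (simp add: tri_vertices_def)
  ultimately show "newton_polytope tri_poly \<subseteq> convex hull tri_vertices"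
    unfolding newton_polytope_def keys_tri_poly by (intro hull_minimal) (auto simp: convex_convex_hull)
  show "convex hull tri_vertices \<subseteq> newton_polytope tri_poly"
    unfolding newton_polytope_def keys_tri_poly tri_vertices_def
    by (intro hull_mono) (auto simp: simplex_pts_iff)
qed

lemma area_tri: "area (convex hull tri_vertices) = real n * (real n + 2) / 2"
proof -
  have "compact (convex hull tri_vertices)"
    by (intro finite_imp_compact_convex_hull) (simp add: tri_vertices_def)
  then have "area (convex hull tri_vertices) = measure lborel (convex hull tri_vertices)"
    unfolding area_def by (intro measure_completion) (simp add: borel_compact)
  then show ?thesis
    unfolding tri_vertices_def content_triangle by (simp add: real_pt_def abs_mult)
qed

lemma tri_in_polytopes_P: "convex hull tri_vertices \<in> polytopes_P"
proof -
  have "sqrt (2 * area (newton_polytope tri_poly)) < real (deg (sm tri_poly))"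
    unfolding newton_polytope_tri_poly area_tri sm_tri_poly
    by (rule real_less_lsqrt) (auto simp: deg_def power2_eq_square algebra_simps)
  then show ?thesis
    unfolding polytopes_P_def using irreducible_tri_poly newton_polytope_tri_poly by blast
qed

lemma simplex_tri: "2 simplex (convex hull tri_vertices)"
proof -
  have "real_pt (0, 0) = 0" by (simp add: real_pt_def vec_eq_iff forall_2)
  then have "\<not> collinear tri_vertices"
    unfolding tri_vertices_def using n_pos
    by (simp add: collinear_lemma) (simp add: real_pt_def vec_eq_iff forall_2)
  then have "\<not> affine_dependent tri_vertices \<and> card tri_vertices = 3"
    unfolding tri_vertices_def collinear_3_eq_affine_dependent by auto
  then show ?thesis unfolding simplex_def by (intro exI[of _ tri_vertices]) simp
qed

lemma card_lattice_tri: "n < card (convex hull tri_vertices \<inter> range real_pt)"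
proof -
  have pt: "real_pt a = real_pt b \<longleftrightarrow> a = b" for a b
    by (auto simp: real_pt_def vec_eq_iff forall_2 prod_eq_iff)
  \<comment> \<open>The bounding box supplies finiteness, without which \<open>card\<close> would be
    0. The lower bound then comes from the n + 1 lattice points of the bottom edge.\<close>
  have "convex hull tri_vertices \<subseteq> cbox (vector [- 1, 0]) (vector [real n, real n + 2])"
    by (rule hull_minimal) (auto simp: tri_vertices_def real_pt_def mem_box_cart forall_2)
  then have "convex hull tri_vertices \<inter> range real_pt \<subseteq> real_pt ` ({- 1..int n} \<times> {0..int n + 2})"
    by (force simp: real_pt_def mem_box_cart forall_2)
  then have "finite (convex hull tri_vertices \<inter> range real_pt)"
    by (rule finite_subset) simp
  moreover have "(\<lambda>i. real_pt (int i, 0)) ` {..n} \<subseteq> convex hull tri_vertices \<inter> range real_pt"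
  proof -
    have "real_pt (int i, 0) \<in> newton_polytope tri_poly" if "i \<le> n" for i
      unfolding newton_polytope_def using that
      by (intro hull_inc) (auto simp: keys_tri_poly simplex_pts_iff)
    then show ?thesis unfolding newton_polytope_tri_poly by auto
  qed
  ultimately have "card ((\<lambda>i. real_pt (int i, 0)) ` {..n}) \<le> card (convex hull tri_vertices \<inter> range real_pt)"
    by (rule card_mono)
  moreover have "card ((\<lambda>i. real_pt (int i, 0)) ` {..n}) = n + 1"
    by (subst card_image) (auto simp: inj_on_def pt)
  ultimately show ?thesis by simp
qed

end

section \<open>Infinitely many orbits\<close>

text \<open>The invariant factors through the quotient by choosing a representative of each class,
  so finitely many classes would bound it.\<close>

lemma infinite_quotient_if_unbounded_invariant:
  fixes N :: "'a \<Rightarrow> nat"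
  assumes inv: "\<And>x y. (x, y) \<in> r \<Longrightarrow> N y = N x"
    and refl: "\<And>x. (x, x) \<in> r"
    and unbounded: "\<And>n. \<exists>x\<in>X. n < N x"
  shows "infinite (X // r)"
proof
  assume "finite (X // r)"
  moreover have "N ` X \<subseteq> (\<lambda>K. N (SOME x. x \<in> K)) ` (X // r)"
  proof
    fix k assume "k \<in> N ` X"
    then obtain x where x: "x \<in> X" "k = N x" by blast
    have "(SOME y. y \<in> r `` {x}) \<in> r `` {x}"
      by (rule someI[of _ x]) (simp add: refl)
    then have "k = N (SOME y. y \<in> r `` {x})" using inv x(2) by auto
    then show "k \<in> (\<lambda>K. N (SOME x. x \<in> K)) ` (X // r)"
      using quotientI[OF x(1)] by blast
  qed
  ultimately have "finite (N ` X)" using finite_surj by blast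
  then obtain m where "\<forall>k\<in>N ` X. k \<le> m" using finite_nat_set_iff_bounded_le by blast
  with unbounded[of m] show False by fastforce
qed

lemma card_lattice_invariant:
  assumes "(P, Q) \<in> affine_lattice_rel"
  shows "card (Q \<inter> range real_pt) = card (P \<inter> range real_pt)"
proof -
  obtain T where T: "bij T" "T ` range real_pt = range real_pt" "Q = T ` P"
    using assms unfolding affine_lattice_rel_def affine_lattice_maps_def by blast
  have "Q \<inter> range real_pt = T ` (P \<inter> range real_pt)"
    using T by (metis bij_is_inj image_Int)
  then show ?thesis using T(1) by (metis bij_is_inj card_image inj_on_subset top_greatest)
qed

theorem theorem33:
  shows "infinite ({P \<in> polytopes_P. 2 simplex P} // affine_lattice_rel)"
proof (rule infinite_quotient_if_unbounded_invariant)
  show "(P, P) \<in> affine_lattice_rel" for P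
    using equiv_affine_lattice_rel by (simp add: equiv_def refl_on_def)
  show "\<exists>P\<in>{P \<in> polytopes_P. 2 simplex P}. n < card (P \<inter> range real_pt)" for n
  proof -
    \<comment> \<open>The triangles exist only for positive parameters, hence n + 1 in place of
      n.\<close>
    have "0 < n + 1" by simp
    from tri_in_polytopes_P[OF this] simplex_tri[OF this] card_lattice_tri[OF this]
    show ?thesis using add_lessD1 by blast
  qed
qed (rule card_lattice_invariant)

end
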